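(* Let $f(z) = R(z) - \overline{z}$, where $R$ is a rational function with $\deg(R) \geq 2$, be regular and satisfy $\lim_{z \to \infty} f(z) = \infty$, and let $z_0 \in \mathbb{C}$. For all sufficiently small $\varepsilon > 0$, if $$F(z) = f(z) + \frac{\varepsilon}{z-z_0}$$ is regular, then the following holds: 1. If $z_0$ is a pole of $f$, then $F$ and $f$ have the same number of zeros. 2. If $0 < |f(z_0)| < \infty$, then there exists $r > 0$ such that $0 < |f(z)| < \infty$ on $D(z_0, r)$, and $F$ has at least one sense-preserving zero in $D(z_0, r)$. 3. If $f(z_0) = 0$ and $|R'(z_0)| > 1$, there exists $r > 0$ such that $F$ has at least two sense-preserving zeros in $D(z_0, r)$. 4. If $f(z_0) = 0$ and $0 < |R'(z_0)| < 1$, there exists $r > 0$ such that $F$ has at least two sense-preserving zeros and two sense-reversing zeros in $D(z_0, r)$. Further, in 2., 3. and 4., $F$ and $f$ have the same number of zeros outside $D(z_0, r)$ (with the respective $r$).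
   Context: The degree of a rational function $R = p/q$ with coprime polynomials $p, q$ is $\deg(R) = \max\{\deg p, \deg q\}$. $D(z,r)$ denotes the open disk of radius $r>0$ around $z \in \mathbb{C}$. For a rational function $R$, let $f(z) = R(z) - \overline{z}$. The poles of $f$ are the poles of $R$. At $z_0\in\mathbb{C}$, $f$ is called sense-preserving if $|R'(z_0)| > 1$ and sense-reversing if $|R'(z_0)| < 1$; if $|R'(z_0)| = 1$, $z_0$ is a singular point. If additionally $f(z_0) = 0$, then $z_0$ is called a sense-preserving, sense-reversing or singular zero of $f$, respectively. A zero that is not singular is called regular. The function $f$ is called regular if all its zeros are regular. The same terminology is applied to $F$, with $R$ replaced by its analytic part $R(z) + \frac{\varepsilon}{z-z_0}$. Zeros are counted as distinct points. *)

theory Defs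
  imports
    "HOL-Complex_Analysis.Complex_Analysis"
    "HOL-Computational_Algebra.Polynomial"
begin

text \<open>
  All notions for \<open>f z = R z - cnj z\<close> are parametrised by the analytic part \<open>R\<close>.
  HOL functions are total, so \<open>R\<close> also has a (meaningless) value at its poles; the
  poles are therefore excluded explicitly wherever \<open>f\<close> or \<open>R'\<close> is evaluated.
\<close>

definition harm_fun :: "(complex \<Rightarrow> complex) \<Rightarrow> complex \<Rightarrow> complex" where
  "harm_fun R z = R z - cnj z"

definition harm_zeros :: "(complex \<Rightarrow> complex) \<Rightarrow> complex set" where
  "harm_zeros R = {z. \<not> is_pole R z \<and> harm_fun R z = 0}"

definition sense_preserving_at :: "(complex \<Rightarrow> complex) \<Rightarrow> complex \<Rightarrow> bool" where
  "sense_preserving_at R z \<longleftrightarrow> \<not> is_pole R z \<and> norm (deriv R z) > 1"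

definition sense_reversing_at :: "(complex \<Rightarrow> complex) \<Rightarrow> complex \<Rightarrow> bool" where
  "sense_reversing_at R z \<longleftrightarrow> \<not> is_pole R z \<and> norm (deriv R z) < 1"

definition singular_at :: "(complex \<Rightarrow> complex) \<Rightarrow> complex \<Rightarrow> bool" where
  "singular_at R z \<longleftrightarrow> \<not> is_pole R z \<and> norm (deriv R z) = 1"

definition sp_zeros :: "(complex \<Rightarrow> complex) \<Rightarrow> complex set" where
  "sp_zeros R = {z \<in> harm_zeros R. sense_preserving_at R z}"

definition sr_zeros :: "(complex \<Rightarrow> complex) \<Rightarrow> complex set" where
  "sr_zeros R = {z \<in> harm_zeros R. sense_reversing_at R z}"

definition harm_regular :: "(complex \<Rightarrow> complex) \<Rightarrow> bool" where
  "harm_regular R \<longleftrightarrow> (\<forall>z \<in> harm_zeros R. \<not> singular_at R z)"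

text \<open>
  The analytic part of \<open>F z = f z + \<epsilon> / (z - z0)\<close>. If \<open>R\<close> has a simple pole
  with residue \<open>-\<epsilon>\<close> at \<open>z0\<close>, the singularity at \<open>z0\<close> is removable and the value
  there is not the continuous extension; for fixed \<open>R\<close> this affects at most one \<open>\<epsilon>\<close>, hence
  no sufficiently small one.
\<close>

definition perturb :: "(complex \<Rightarrow> complex) \<Rightarrow> complex \<Rightarrow> real \<Rightarrow> complex \<Rightarrow> complex" where
  "perturb R z0 \<epsilon> z = R z + of_real \<epsilon> / (z - z0)"

lemma harm_fun_perturb: "harm_fun (perturb R z0 \<epsilon>) z = harm_fun R z + of_real \<epsilon> / (z - z0)"
  by (simp add: harm_fun_def perturb_def)

text \<open>Finiteness is required because \<open>card\<close> is \<open>0\<close> on infinite sets.\<close>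

definition same_number :: "'a set \<Rightarrow> 'a set \<Rightarrow> bool" where
  "same_number A B \<longleftrightarrow> finite A \<and> finite B \<and> card A = card B"

end

theory Submission imports Defs begin

text \<open>
  Where \<open>H'\<close> stays close to a number \<open>a\<close> with \<open>|a| \<noteq> 1\<close>, the real-linear map \<open>w \<mapsto> a w - cnj w\<close> is
  invertible with lower bound \<open>||a| - 1|\<close>, so by the Banach fixed point theorem \<open>H z - cnj z\<close> has
  exactly one zero near any point where it is small enough.  Consequently each regular zero of
  \<open>f\<close> away from \<open>z0\<close> persists as a single zero of \<open>F\<close>, and, since \<open>|f|\<close> is bounded below away from
  its zeros, no others appear there.  Near \<open>z0\<close> the same principle applies in scaled coordinates:
  for \<open>f z0 \<noteq> 0\<close> at \<open>z0 - \<epsilon> / f z0\<close> on the scale \<open>\<epsilon>\<close>, and for \<open>f z0 = 0\<close>, \<open>a = R' z0\<close>, at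
  \<open>z0 \<plusminus> sqrt \<epsilon> u\<close> on the scale \<open>sqrt \<epsilon>\<close>, where \<open>u\<close> solves \<open>a u - cnj u + 1 / u = 0\<close>.  At a pole,
  \<open>|R z| \<ge> C / |z - z0|\<close> dominates the perturbation.
\<close>

section \<open>Zeros of harmonic maps by contraction\<close>

lemma isCont_imp_tendsto_nhds: "isCont f x \<Longrightarrow> (f \<longlongrightarrow> f x) (nhds x)"
  by (simp add: isCont_def tendsto_at_iff_tendsto_nhds)

lemma isCont_imp_eventually_close:
  assumes "isCont f x" "e > 0" shows "\<forall>\<^sub>F y in nhds x. dist (f y) (f x) < e"
  using tendstoD [OF isCont_imp_tendsto_nhds [OF assms(1)] assms(2)] .

text \<open>This is a simplified Newton iteration with the linear part frozen at
  \<open>w \<mapsto> a w - cnj w\<close>. The inverse of that map has norm at most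
  \<open>1 / m\<close>, and \<open>H z - a z\<close> is \<open>m / 2\<close>-Lipschitz on the disk,
  so \<open>T\<close> contracts with factor 1/2. Smallness at \<open>c\<close> keeps the iterates in
  the disk.\<close>

lemma harm_zero_ex1:
  fixes H H' :: "complex \<Rightarrow> complex"
  assumes r: "0 < r" and a: "norm a \<noteq> 1" and m: "m = \<bar>norm a - 1\<bar>"
    and der: "\<And>z. z \<in> ball c r \<Longrightarrow> (H has_field_derivative H' z) (at z)"
    and bd: "\<And>z. z \<in> ball c r \<Longrightarrow> norm (H' z - a) \<le> m / 2"
    and small: "norm (H c - cnj c) < m * r / 2"
  shows "\<exists>!z. z \<in> ball c r \<and> H z = cnj z"
proof -
  define L where "L w = a * w - cnj w" for w
  \<comment> \<open>Eliminating \<open>cnj w\<close> between \<open>v = a w - cnj w\<close> and its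
    conjugate gives \<open>cnj a * v + cnj v = (|a|\<^sup>2 - 1) w\<close>.\<close>
  define Linv where "Linv v = (cnj a * v + cnj v) / of_real ((norm a)\<^sup>2 - 1)" for v
  define T where "T z = z - Linv (H z - cnj z)" for z
  have m0: "m > 0" using a m by auto
  have na: "(norm a)\<^sup>2 - 1 = (norm a - 1) * (norm a + 1)"
    by (simp add: algebra_simps power2_eq_square)
  then have na0: "(norm a)\<^sup>2 - 1 \<noteq> 0"
    using a by (metis add_eq_0_iff add_nonneg_eq_0_iff eq_iff_diff_eq_0 mult_eq_0_iff norm_ge_zero zero_le_one zero_neq_one)
  have abs_na: "\<bar>(norm a)\<^sup>2 - 1\<bar> = m * (norm a + 1)"
    unfolding na m by (simp add: abs_mult)
  have LL: "Linv (L w) = w" for w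
  proof -
    have "cnj a * L w + cnj (L w) = (a * cnj a - 1) * w"
      by (simp add: L_def algebra_simps)
    also have "a * cnj a - 1 = of_real ((norm a)\<^sup>2 - 1)"
      by (simp add: complex_norm_square [symmetric])
    finally show ?thesis
      using na0 unfolding Linv_def
      by (metis nonzero_mult_div_cancel_left of_real_eq_0_iff)
  qed
  have Linv_diff: "Linv (v - w) = Linv v - Linv w" for v w
    by (simp add: Linv_def algebra_simps diff_divide_distrib add_divide_distrib)
  have Linv_bd: "norm (Linv v) \<le> norm v / m" for v
  proof -
    have "norm (cnj a * v + cnj v) \<le> (norm a + 1) * norm v"
      by (rule order_trans [OF norm_triangle_ineq]) (simp add: norm_mult algebra_simps)
    then have "norm (Linv v) \<le> (norm a + 1) * norm v / (m * (norm a + 1))"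
      unfolding Linv_def norm_divide norm_of_real abs_na
      using m0 by (intro divide_right_mono) auto
    moreover have "norm a + 1 \<noteq> 0" using norm_ge_zero [of a] by linarith
    ultimately show ?thesis by simp
  qed
  have Linv_eq0: "v = 0" if "Linv v = 0" for v
  proof -
    have "cnj a * v + cnj v = 0"
      using that na0 unfolding Linv_def by (metis divide_eq_0_iff of_real_eq_0_iff)
    then have "cnj v = - (cnj a * v)" by (simp add: add_eq_0_iff)
    then have "norm v = norm a * norm v"
      by (metis complex_mod_cnj norm_minus_cancel norm_mult)
    then show ?thesis using a by auto
  qed
  have Lip: "norm ((H z - a * z) - (H y - a * y)) \<le> m / 2 * norm (z - y)"
    if "z \<in> ball c r" "y \<in> ball c r" for z y
  proof (rule field_differentiable_bound [where S = "ball c r" and f' = "\<lambda>z. H' z - a"])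
    show "((\<lambda>z. H z - a * z) has_field_derivative H' w - a) (at w within ball c r)"
      if "w \<in> ball c r" for w
      using has_field_derivative_at_within [OF der [OF that], of "ball c r"]
      by (auto intro!: derivative_eq_intros)
  qed (use that bd in auto)
  have T_lip: "dist (T z) (T y) \<le> 1 / 2 * dist z y"
    if "z \<in> ball c r" "y \<in> ball c r" for z y
  proof -
    have "T z - T y = Linv (L (z - y)) - (Linv (H z - cnj z) - Linv (H y - cnj y))"
      unfolding LL by (simp add: T_def)
    also have "\<dots> = Linv (- ((H z - a * z) - (H y - a * y)))"
      unfolding Linv_diff [symmetric] by (simp add: L_def algebra_simps)
    finally have "norm (T z - T y) \<le> norm ((H z - a * z) - (H y - a * y)) / m"
      using Linv_bd by (metis norm_minus_cancel)
    also have "\<dots> \<le> (m / 2 * norm (z - y)) / m"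
      using Lip [OF that] m0 by (intro divide_right_mono) auto
    finally show ?thesis using m0 by (simp add: dist_norm)
  qed
  have Tfix: "T z = z \<longleftrightarrow> H z = cnj z" for z
    using Linv_eq0 [of "H z - cnj z"] by (auto simp: T_def Linv_def)
  \<comment> \<open>The fixed point theorem needs a complete set, hence a closed disk inside the
    open one. With this radius the first step moves \<open>c\<close> by at most
    \<open>r' / 2\<close>, so factor 1/2 makes the disk invariant. If \<open>r' = 0\<close>, the
    disk is \<open>{c}\<close>.\<close>
  define r' where "r' = 2 * norm (H c - cnj c) / m"
  have r': "0 \<le> r'" "r' < r" "norm (H c - cnj c) = m * r' / 2"
    using small m0 by (auto simp: r'_def field_simps)
  have sub: "cball c r' \<subseteq> ball c r" using r' by auto
  have "\<exists>!z\<in>cball c r'. T z = z"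
  proof (rule Banach_fix)
    show "complete (cball c r')" by (simp add: complete_eq_closed)
    show "cball c r' \<noteq> {}" using r' by simp
    show "T ` cball c r' \<subseteq> cball c r'"
    proof safe
      fix z assume z: "z \<in> cball c r'"
      have "dist (T z) c \<le> dist (T z) (T c) + dist (T c) c" by (rule dist_triangle)
      also have "dist (T z) (T c) \<le> 1 / 2 * dist z c"
        using z sub r by (intro T_lip) auto
      also have "dist (T c) c \<le> r' / 2"
        using Linv_bd [of "H c - cnj c"] m0 unfolding r'(3) by (simp add: T_def dist_norm)
      also have "1 / 2 * dist z c \<le> r' / 2" using z by (simp add: dist_commute)
      finally show "T z \<in> cball c r'" by (simp add: dist_commute)
    qed
    show "dist (T z) (T y) \<le> 1 / 2 * dist z y" if "z \<in> cball c r'" "y \<in> cball c r'" for z y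
      using T_lip that sub by blast
  qed auto
  then obtain z where z: "z \<in> ball c r" "T z = z" using sub by blast
  show ?thesis
  proof (rule ex1I [of _ z])
    show "z \<in> ball c r \<and> H z = cnj z" using z Tfix by simp
    \<comment> \<open>Uniqueness on the whole open disk comes from the contraction estimate, since
      the fixed point theorem covers only the smaller closed disk.\<close>
    show "y = z" if "y \<in> ball c r \<and> H y = cnj y" for y
      using T_lip [of y z] z that Tfix [of y] by auto
  qed
qed

text \<open>By the reverse triangle inequality \<open>norm b\<close> stays on the same side of 1 as
  \<open>norm a\<close>. The sense of a zero found by contraction can thus be read off from the
  model derivative \<open>a\<close>.\<close>

lemma sense_of_deriv_near:
  fixes a b :: complex
  assumes "norm (b - a) \<le> \<bar>norm a - 1\<bar> / 2"
  shows "norm a > 1 \<Longrightarrow> norm b > 1" and "norm a < 1 \<Longrightarrow> norm b < 1"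
  using assms norm_triangle_ineq2 [of a b] norm_triangle_ineq2 [of b a]
  by (auto simp: norm_minus_commute)

text \<open>A local condition, so that it can be checked point by point for the perturbed function
  too. Analyticity on \<open>{z}\<close> refers to a neighbourhood of \<open>z\<close> and also
  fixes the value at \<open>z\<close>, which rules out a removable singularity with an arbitrary
  value.\<close>

definition pole_or_analytic :: "(complex \<Rightarrow> complex) \<Rightarrow> bool" where
  "pole_or_analytic H \<longleftrightarrow> (\<forall>z. is_pole H z \<or> H analytic_on {z})"

lemma analytic_at_imp_not_is_pole:
  assumes "H analytic_on {z}" shows "\<not> is_pole H z"
proof -
  have "H \<midarrow>z\<rightarrow> H z" using analytic_at_imp_isCont [OF assms] by (simp add: isCont_def)
  then show ?thesis
    unfolding is_pole_def using not_tendsto_and_filterlim_at_infinity trivial_limit_at by blast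
qed

lemma pole_or_analytic_iff:
  assumes "pole_or_analytic H" shows "\<not> is_pole H z \<longleftrightarrow> H analytic_on {z}"
  using assms analytic_at_imp_not_is_pole unfolding pole_or_analytic_def by blast

lemma eventually_deriv_close:
  fixes H :: "complex \<Rightarrow> complex"
  assumes "H analytic_on {c}" and "e > 0"
  shows "\<forall>\<^sub>F z in nhds c. H analytic_on {z} \<and> norm (deriv H z - deriv H c) < e"
proof -
  obtain S where S: "open S" "c \<in> S" "H holomorphic_on S"
    using assms(1) by (auto simp: analytic_at)
  have "isCont (deriv H) c"
    using assms(1) by (intro analytic_at_imp_isCont analytic_intros)
  then have "\<forall>\<^sub>F z in nhds c. dist (deriv H z) (deriv H c) < e"
    using assms(2) by (rule isCont_imp_eventually_close)
  moreover have "\<forall>\<^sub>F z in nhds c. z \<in> S" using S by (intro eventually_nhds_in_open) auto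
  ultimately show ?thesis
    by eventually_elim (use S in \<open>auto simp: dist_norm analytic_at\<close>)
qed

section \<open>Isolation and finiteness of the zeros, lower bound away from them\<close>

lemma harm_fun_at_pole:
  assumes "is_pole H z" shows "filterlim (harm_fun H) at_infinity (at z)"
proof -
  have "filterlim (\<lambda>w. - cnj w + H w) at_infinity (at z)"
    using assms unfolding is_pole_def
    by (intro tendsto_add_filterlim_at_infinity) (auto intro!: tendsto_intros)
  then show ?thesis by (simp add: harm_fun_def [abs_def])
qed

text \<open>At a pole the function is large nearby, and at a point of nonzero value continuity
  suffices. At a zero, regularity makes \<open>harm_zero_ex1\<close> applicable with
  \<open>a = deriv H c\<close>, and its uniqueness part excludes further zeros.\<close>

lemma isolated_harm_zeros:
  assumes H: "pole_or_analytic H" and reg: "harm_regular H"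
  shows "\<forall>\<^sub>F z in at c. z \<notin> harm_zeros H"
proof (cases "is_pole H c")
  case True
  then have "\<forall>\<^sub>F z in at c. norm (harm_fun H z) \<ge> 1"
    using harm_fun_at_pole filterlim_at_infinity [of 0 "harm_fun H" "at c"] by auto
  then show ?thesis
    by eventually_elim (auto simp: harm_zeros_def)
next
  case False
  then have an: "H analytic_on {c}" using H pole_or_analytic_iff by blast
  show ?thesis
  proof (cases "harm_fun H c = 0")
    case True
    with False have "norm (deriv H c) \<noteq> 1"
      using reg by (auto simp: harm_regular_def harm_zeros_def singular_at_def)
    define m where "m = \<bar>norm (deriv H c) - 1\<bar>"
    have m0: "m > 0" using \<open>norm (deriv H c) \<noteq> 1\<close> by (auto simp: m_def)
    obtain d where d: "d > 0"
      "\<And>z. z \<in> ball c d \<Longrightarrow> H analytic_on {z} \<and> norm (deriv H z - deriv H c) < m / 2"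
      using eventually_deriv_close [OF an, of "m/2"] m0
      unfolding eventually_nhds_metric by (auto simp: dist_commute)
    have "\<exists>!z. z \<in> ball c d \<and> H z = cnj z"
    proof (rule harm_zero_ex1 [where H' = "deriv H"])
      show "(H has_field_derivative deriv H z) (at z)" if "z \<in> ball c d" for z
        using d(2) [OF that] by (intro analytic_derivI) auto
      show "norm (deriv H z - deriv H c) \<le> m / 2" if "z \<in> ball c d" for z
        using d(2) [OF that] by auto
    qed (use True d m0 \<open>norm (deriv H c) \<noteq> 1\<close> in \<open>auto simp: harm_fun_def m_def\<close>)
    moreover have "c \<in> ball c d" "H c = cnj c" using d True by (auto simp: harm_fun_def)
    ultimately have "z \<notin> harm_zeros H" if "z \<in> ball c d" "z \<noteq> c" for z
      using that unfolding harm_zeros_def harm_fun_def by (metis (mono_tags, lifting) eq_iff_diff_eq_0 mem_Collect_eq)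
    then show ?thesis
      unfolding eventually_at using d(1) by (auto simp: dist_commute)
  next
    case False
    have "isCont (harm_fun H) c"
      unfolding harm_fun_def [abs_def]
      using analytic_at_imp_isCont [OF an] by (intro continuous_intros)
    then have "\<forall>\<^sub>F z in at c. harm_fun H z \<noteq> 0"
      using False by (intro tendsto_imp_eventually_ne) (auto simp: isCont_def)
    then show ?thesis
      by eventually_elim (auto simp: harm_zeros_def)
  qed
qed

lemma harm_fun_ge_1_outside:
  assumes "filterlim (harm_fun H) at_infinity at_infinity"
  obtains B where "\<And>z. norm z \<ge> B \<Longrightarrow> norm (harm_fun H z) \<ge> 1"
proof -
  have "\<forall>\<^sub>F z in at_infinity. norm (harm_fun H z) \<ge> 1"
    using assms filterlim_at_infinity [of 0 "harm_fun H" at_infinity] by auto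
  then show thesis using that unfolding eventually_at_infinity by blast
qed

text \<open>Growth at infinity confines the zeros to a compact disk. Infinitely many would
  accumulate there, against isolation, which holds at every point and not only at zeros.\<close>

lemma finite_harm_zeros:
  assumes H: "pole_or_analytic H" and reg: "harm_regular H"
    and inf: "filterlim (harm_fun H) at_infinity at_infinity"
  shows "finite (harm_zeros H)"
proof -
  obtain B where B: "\<And>z. norm z \<ge> B \<Longrightarrow> norm (harm_fun H z) \<ge> 1"
    using harm_fun_ge_1_outside [OF inf] by blast
  have sub: "harm_zeros H \<subseteq> cball 0 B"
  proof
    fix z assume "z \<in> harm_zeros H"
    then have "\<not> norm (harm_fun H z) \<ge> 1" by (simp add: harm_zeros_def)
    then show "z \<in> cball 0 B" using B [of z] by (simp add: dist_norm) (metis linear)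
  qed
  show ?thesis
  proof (rule ccontr)
    assume "infinite (harm_zeros H)"
    then obtain x where "x islimpt harm_zeros H"
      using Heine_Borel_imp_Bolzano_Weierstrass [OF compact_cball _ sub] by blast
    moreover have "\<not> x islimpt harm_zeros H"
      using isolated_harm_zeros [OF H reg, of x]
      unfolding islimpt_iff_eventually by simp
    ultimately show False by blast
  qed
qed


text \<open>Each point of the compact part of \<open>A\<close> has a neighbourhood with its own
  lower bound: 1 at a pole, half the modulus elsewhere. A finite subcover gives a common bound, and
  outside a large disk the bound is 1.\<close>

lemma harm_fun_lower_bound:
  assumes H: "pole_or_analytic H"
    and inf: "filterlim (harm_fun H) at_infinity at_infinity"
    and A: "closed A" "A \<inter> harm_zeros H = {}"
  obtains c where "c > 0" "\<And>z. z \<in> A \<Longrightarrow> \<not> is_pole H z \<Longrightarrow> c \<le> norm (harm_fun H z)"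
proof -
  obtain B where B: "\<And>z. norm z \<ge> B \<Longrightarrow> norm (harm_fun H z) \<ge> 1"
    using harm_fun_ge_1_outside [OF inf] by blast
  define K where "K = A \<inter> cball 0 B"
  have "compact K" unfolding K_def using A by (intro closed_Int_compact) auto
  have "\<exists>c U. c > 0 \<and> open U \<and> x \<in> U \<and>
      (\<forall>z\<in>U. \<not> is_pole H z \<longrightarrow> c \<le> norm (harm_fun H z))" if "x \<in> K" for x
  proof (cases "is_pole H x")
    case True
    then have "\<forall>\<^sub>F z in at x. norm (harm_fun H z) \<ge> 1"
      using harm_fun_at_pole filterlim_at_infinity [of 0 "harm_fun H" "at x"] by auto
    then obtain U where "open U" "x \<in> U" "\<And>z. z \<in> U \<Longrightarrow> z \<noteq> x \<Longrightarrow> norm (harm_fun H z) \<ge> 1"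
      unfolding eventually_at_topological by blast
    then show ?thesis using True by (intro exI [of _ 1] exI [of _ U]) auto
  next
    case False
    then have an: "H analytic_on {x}" using H pole_or_analytic_iff by blast
    have nz: "harm_fun H x \<noteq> 0"
      using that A False by (auto simp: K_def harm_zeros_def)
    have "isCont (\<lambda>z. norm (harm_fun H z)) x"
      unfolding harm_fun_def using analytic_at_imp_isCont [OF an] by (intro continuous_intros)
    then have "((\<lambda>z. norm (harm_fun H z)) \<longlongrightarrow> norm (harm_fun H x)) (nhds x)"
      by (rule isCont_imp_tendsto_nhds)
    then have "\<forall>\<^sub>F z in nhds x. norm (harm_fun H z) > norm (harm_fun H x) / 2"
      using nz by (intro order_tendstoD) auto
    then obtain U where "open U" "x \<in> U" "\<And>z. z \<in> U \<Longrightarrow> norm (harm_fun H z) > norm (harm_fun H x) / 2"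
      unfolding eventually_nhds by blast
    then show ?thesis
      using nz by (intro exI [of _ "norm (harm_fun H x) / 2"] exI [of _ U]) force
  qed
  then obtain c U where cU: "\<And>x. x \<in> K \<Longrightarrow> c x > 0 \<and> open (U x) \<and> x \<in> U x \<and>
      (\<forall>z\<in>U x. \<not> is_pole H z \<longrightarrow> c x \<le> norm (harm_fun H z))" by metis
  obtain D where D: "D \<subseteq> K" "finite D" "K \<subseteq> (\<Union>x\<in>D. U x)"
    using compactE_image [OF \<open>compact K\<close>, of K U] cU by blast
  \<comment> \<open>The inserted 1 serves the exterior of the large disk and keeps the minimum
    meaningful when \<open>D\<close> is empty.\<close>
  define e where "e = Min (insert 1 (c ` D))"
  show thesis
  proof (rule that)
    show "e > 0" using D cU unfolding e_def by (subst Min_gr_iff) auto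
    fix z assume z: "z \<in> A" "\<not> is_pole H z"
    show "e \<le> norm (harm_fun H z)"
    proof (cases "norm z \<ge> B")
      case True
      have "e \<le> 1" using D unfolding e_def by (intro Min_le) auto
      then show ?thesis using B [OF True] by linarith
    next
      case False
      then have "z \<in> K" using z by (auto simp: K_def)
      then obtain x where x: "x \<in> D" "z \<in> U x" using D by blast
      then have "e \<le> c x" using D unfolding e_def by (intro Min_le) auto
      then show ?thesis using x D cU z by fastforce
    qed
  qed
qed

section \<open>Zeros away from the perturbation\<close>

text \<open>Undoing the perturbation lets one implication of \<open>is_pole_perturb\<close> yield
  the converse.\<close>

lemma perturb_perturb: "perturb (perturb H z0 \<epsilon>) z0 (- \<epsilon>) = H"
  by (simp add: perturb_def fun_eq_iff)

lemma is_pole_perturb: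
  assumes "z \<noteq> z0" shows "is_pole (perturb H z0 \<epsilon>) z \<longleftrightarrow> is_pole H z"
proof -
  have *: "is_pole (perturb F z0 t) z" if "is_pole F z" for F t
  proof -
    have "filterlim (\<lambda>w. of_real t / (w - z0) + F w) at_infinity (at z)"
      using that assms unfolding is_pole_def
      by (intro tendsto_add_filterlim_at_infinity) (auto intro!: tendsto_eq_intros)
    then show ?thesis by (simp add: perturb_def [abs_def] is_pole_def add.commute)
  qed
  show ?thesis using * [of H \<epsilon>] * [of "perturb H z0 \<epsilon>" "- \<epsilon>"] perturb_perturb by auto
qed

lemma analytic_perturb:
  assumes "H analytic_on {z}" "z \<noteq> z0"
  shows "perturb H z0 \<epsilon> analytic_on {z}"
    and "deriv (perturb H z0 \<epsilon>) z = deriv H z - of_real \<epsilon> / (z - z0)\<^sup>2"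
proof -
  show "perturb H z0 \<epsilon> analytic_on {z}"
    unfolding perturb_def [abs_def] using assms by (intro analytic_intros) auto
  have "(H has_field_derivative deriv H z) (at z)"
    using assms(1) by (intro analytic_derivI)
  then have "(perturb H z0 \<epsilon> has_field_derivative deriv H z - of_real \<epsilon> / (z - z0)\<^sup>2) (at z)"
    unfolding perturb_def [abs_def] using assms(2)
    by (auto intro!: derivative_eq_intros simp: power2_eq_square)
  then show "deriv (perturb H z0 \<epsilon>) z = deriv H z - of_real \<epsilon> / (z - z0)\<^sup>2"
    by (rule DERIV_imp_deriv)
qed

lemma filterlim_harm_fun_perturb:
  assumes "filterlim (harm_fun H) at_infinity at_infinity"
  shows "filterlim (harm_fun (perturb H z0 \<epsilon>)) at_infinity at_infinity"
proof -
  have "((\<lambda>z. of_real \<epsilon> / (z - z0)) \<longlongrightarrow> 0) at_infinity"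
    using tendsto_add_filterlim_at_infinity [OF tendsto_const [of "- z0"] filterlim_ident]
    by (intro tendsto_divide_0 [OF tendsto_const]) simp
  then have "filterlim (\<lambda>z. of_real \<epsilon> / (z - z0) + harm_fun H z) at_infinity at_infinity"
    using assms by (rule tendsto_add_filterlim_at_infinity)
  then show ?thesis by (simp add: harm_fun_perturb [abs_def] add.commute)
qed

lemma eventually_at_right_ball:
  fixes z :: "'a :: metric_space"
  assumes "\<forall>\<^sub>F y in nhds z. P y"
  shows "\<forall>\<^sub>F d in at_right (0::real). \<forall>y\<in>ball z d. P y"
proof -
  obtain d where "d > 0" "\<And>y. dist y z < d \<Longrightarrow> P y"
    using assms unfolding eventually_nhds_metric by blast
  then show ?thesis
    unfolding eventually_at_right_field by (intro exI [of _ d]) (auto simp: dist_commute)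
qed

lemma eventually_at_right_times_less:
  fixes C e :: real
  assumes "e > 0" shows "\<forall>\<^sub>F x in at_right 0. x * C < e"
proof -
  have "((\<lambda>x. x * C) \<longlongrightarrow> 0 * C) (at_right 0)" by (intro tendsto_intros)
  then show ?thesis using assms by (intro order_tendstoD) auto
qed

text \<open>Outside the ball the perturbation is at most \<open>\<epsilon> / r\<close>. Small disks
  about the old zeros each contain exactly one new zero by contraction. Off these disks the old
  function exceeds \<open>\<epsilon> / r\<close> in modulus, so nothing else appears. The zero-free
  sphere keeps the disks clear of the ball.\<close>

lemma eventually_same_number_outside_ball:
  assumes H: "pole_or_analytic H" and reg: "harm_regular H"
    and inf: "filterlim (harm_fun H) at_infinity at_infinity"
    and r: "r > 0" and sph: "harm_zeros H \<inter> sphere z0 r = {}"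
  shows "\<forall>\<^sub>F \<epsilon> in at_right 0.
    same_number (harm_zeros (perturb H z0 \<epsilon>) - ball z0 r) (harm_zeros H - ball z0 r)"
proof -
  define Z where "Z = harm_zeros H - ball z0 r"
  have finZ: "finite Z" using finite_harm_zeros [OF H reg inf] by (simp add: Z_def)
  define m where "m z = \<bar>norm (deriv H z) - 1\<bar>" for z
  have Z: "H z = cnj z" "H analytic_on {z}" "norm (deriv H z) \<noteq> 1" "m z > 0" "dist z0 z > r"
    if "z \<in> Z" for z
  proof -
    have z: "\<not> is_pole H z" "harm_fun H z = 0" "z \<in> harm_zeros H" "z \<notin> ball z0 r"
      using that by (auto simp: Z_def harm_zeros_def)
    show "H z = cnj z" using z by (simp add: harm_fun_def)
    show "H analytic_on {z}" using z pole_or_analytic_iff [OF H] by blast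
    show "norm (deriv H z) \<noteq> 1" using z reg by (auto simp: harm_regular_def singular_at_def)
    then show "m z > 0" by (simp add: m_def)
    show "dist z0 z > r" using z sph by (cases "dist z0 z = r") auto
  qed
  \<comment> \<open>The last condition, that \<open>y\<close> is closer to \<open>z\<close> than to
    any other zero, later makes the map from old to new zeros injective.\<close>
  define Q where "Q z y \<longleftrightarrow> (H analytic_on {y} \<and> norm (deriv H y - deriv H z) < m z / 4) \<and>
      dist z0 y > r \<and> (\<forall>z'\<in>Z-{z}. dist z y < dist z' y)" for z y
  have Q_nhds: "\<forall>\<^sub>F y in nhds z. Q z y" if z: "z \<in> Z" for z
  proof -
    have "\<forall>\<^sub>F y in nhds z. H analytic_on {y} \<and> norm (deriv H y - deriv H z) < m z / 4"
      using Z [OF z] by (intro eventually_deriv_close) auto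
    moreover have "open {y. dist z0 y > r}" by (intro open_Collect_less continuous_intros)
    then have "\<forall>\<^sub>F y in nhds z. dist z0 y > r"
      using Z [OF z] eventually_nhds_in_open [of "{y. dist z0 y > r}" z] by simp
    moreover have "\<forall>\<^sub>F y in nhds z. dist z y < dist z' y" if "z' \<in> Z - {z}" for z'
    proof -
      have "open {y. dist z y < dist z' y}" by (intro open_Collect_less continuous_intros)
      then show ?thesis using that eventually_nhds_in_open [of "{y. dist z y < dist z' y}" z] by simp
    qed
    then have "\<forall>\<^sub>F y in nhds z. \<forall>z'\<in>Z-{z}. dist z y < dist z' y"
      using finZ by (intro eventually_ball_finite ballI) auto
    ultimately show ?thesis by eventually_elim (simp add: Q_def)
  qed
  have "\<forall>\<^sub>F d in at_right (0::real). \<forall>z\<in>Z. \<forall>y\<in>ball z d. Q z y"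
    using finZ Q_nhds by (intro eventually_ball_finite ballI eventually_at_right_ball) auto
  then have "\<forall>\<^sub>F d in at_right (0::real). d > 0 \<and> (\<forall>z\<in>Z. \<forall>y\<in>ball z d. Q z y)"
    using eventually_at_right_less [of "0::real"] by eventually_elim auto
  then obtain d where d: "d > 0" "\<And>z y. z \<in> Z \<Longrightarrow> y \<in> ball z d \<Longrightarrow> Q z y"
    using eventually_happens' [OF trivial_limit_at_right_real] by blast
  define A where "A = - ball z0 r - (\<Union>z\<in>Z. ball z d)"
  have "closed A" unfolding A_def by (intro closed_Diff) auto
  moreover have "A \<inter> harm_zeros H = {}" using d(1) by (auto simp: A_def Z_def)
  ultimately obtain c where c: "c > 0"
    "\<And>z. z \<in> A \<Longrightarrow> \<not> is_pole H z \<Longrightarrow> c \<le> norm (harm_fun H z)"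
    using harm_fun_lower_bound [OF H inf] by metis
  \<comment> \<open>Three thresholds: the change of the derivative takes up the other half of the
    budget \<open>m z / 2\<close>, the change of the value at an old zero meets the smallness
    condition on the disk of radius \<open>d\<close>, and the perturbation stays below the lower
    bound \<open>c\<close> on \<open>A\<close>.\<close>
  have "\<forall>\<^sub>F \<epsilon> in at_right 0. \<forall>z\<in>Z. \<epsilon> * (1 / r\<^sup>2) < m z / 4"
    using finZ Z by (intro eventually_ball_finite ballI eventually_at_right_times_less) auto
  moreover have "\<forall>\<^sub>F \<epsilon> in at_right 0. \<forall>z\<in>Z. \<epsilon> * (1 / r) < m z * d / 2"
    using finZ Z d by (intro eventually_ball_finite ballI eventually_at_right_times_less) auto
  moreover have "\<forall>\<^sub>F \<epsilon> in at_right 0. \<epsilon> * (1 / r) < c"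
    using c by (intro eventually_at_right_times_less)
  moreover have "\<forall>\<^sub>F \<epsilon> in at_right (0::real). \<epsilon> > 0" by (rule eventually_at_right_less)
  ultimately show ?thesis
  proof eventually_elim
    case (elim \<epsilon>)
    define G where "G = perturb H z0 \<epsilon>"
    have small: "norm (of_real \<epsilon> / (y - z0)) \<le> \<epsilon> / r" if "dist z0 y \<ge> r" for y
      using that elim r unfolding norm_divide
      by (auto simp: dist_norm norm_minus_commute intro!: divide_left_mono mult_pos_pos)
    have small2: "norm (of_real \<epsilon> / (y - z0)\<^sup>2) \<le> \<epsilon> / r\<^sup>2" if "dist z0 y \<ge> r" for y
      using that elim r unfolding norm_divide norm_power
      by (auto simp: dist_norm norm_minus_commute intro!: divide_left_mono mult_pos_pos power_mono)
    have anG: "G analytic_on {y}" "deriv G y = deriv H y - of_real \<epsilon> / (y - z0)\<^sup>2"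
      if "z \<in> Z" "y \<in> ball z d" for z y
      using d(2) [OF that] r unfolding G_def Q_def by (auto intro!: analytic_perturb)
    have ex1: "\<exists>!y. y \<in> ball z d \<and> G y = cnj y" if z: "z \<in> Z" for z
    proof (rule harm_zero_ex1 [where H' = "deriv G" and a = "deriv H z" and m = "m z"])
      show "(G has_field_derivative deriv G y) (at y)" if "y \<in> ball z d" for y
        using anG [OF z that] by (intro analytic_derivI) auto
      show "norm (deriv G y - deriv H z) \<le> m z / 2" if "y \<in> ball z d" for y
      proof -
        have "norm (deriv G y - deriv H z) = norm ((deriv H y - deriv H z) - of_real \<epsilon> / (y - z0)\<^sup>2)"
          by (simp add: anG [OF z that] algebra_simps)
        also have "\<dots> \<le> norm (deriv H y - deriv H z) + norm (of_real \<epsilon> / (y - z0)\<^sup>2)"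
          by (rule norm_triangle_ineq4)
        also have "norm (of_real \<epsilon> / (y - z0)\<^sup>2) \<le> \<epsilon> / r\<^sup>2"
          using d(2) [OF z that] by (intro small2) (simp add: Q_def)
        finally show ?thesis
          using d(2) [OF z that] bspec [OF elim(1) z]
          unfolding Q_def times_divide_eq_right mult_1_right by linarith
      qed
      show "norm (G z - cnj z) < m z * d / 2"
      proof -
        have "norm (G z - cnj z) \<le> \<epsilon> / r"
          using small [of z] Z [OF z] by (simp add: G_def perturb_def)
        also have "\<dots> < m z * d / 2" using bspec [OF elim(2) z] by simp
        finally show ?thesis .
      qed
    qed (use Z [OF z] d in \<open>auto simp: m_def\<close>)
    define g where "g z = (THE y. y \<in> ball z d \<and> G y = cnj y)" for z
    have g: "g z \<in> ball z d" "G (g z) = cnj (g z)" if "z \<in> Z" for z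
      using theI' [OF ex1 [OF that]] by (auto simp: g_def)
    have "harm_zeros G - ball z0 r = g ` Z"
    proof safe
      fix z assume z: "z \<in> Z"
      show "g z \<in> harm_zeros G"
        using g [OF z] anG(1) [OF z g(1) [OF z]] analytic_at_imp_not_is_pole
        by (auto simp: harm_zeros_def harm_fun_def)
      show False if "g z \<in> ball z0 r"
        using d(2) [OF z g(1) [OF z]] that by (simp add: Q_def)
    next
      fix y assume y: "y \<in> harm_zeros G" "y \<notin> ball z0 r"
      then have "y \<noteq> z0" using r by auto
      have Gy: "\<not> is_pole G y" "G y = cnj y" using y by (auto simp: harm_zeros_def harm_fun_def)
      show "y \<in> g ` Z"
      proof (rule ccontr)
        assume *: "y \<notin> g ` Z"
        have "y \<notin> ball z d" if "z \<in> Z" for z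
          using the1_equality [OF ex1 [OF that], of y] Gy * that unfolding g_def by blast
        then have "y \<in> A" using y by (auto simp: A_def)
        then have "c \<le> norm (harm_fun H y)"
          using c(2) Gy(1) is_pole_perturb [OF \<open>y \<noteq> z0\<close>] by (auto simp: G_def)
        also have "harm_fun H y = - (of_real \<epsilon> / (y - z0))"
          using Gy(2) by (simp add: G_def perturb_def harm_fun_def algebra_simps add_eq_0_iff)
        also have "norm \<dots> \<le> \<epsilon> / r"
          unfolding norm_minus_cancel using y by (intro small) auto
        finally show False using elim by simp
      qed
    qed
    moreover have "inj_on g Z"
    proof (rule inj_onI, rule ccontr)
      fix z z' assume z: "z \<in> Z" "z' \<in> Z" "g z = g z'" "z \<noteq> z'"
      then have "dist z (g z) < dist z' (g z)" "dist z' (g z) < dist z (g z)"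
        using d(2) [OF z(1) g(1)] d(2) [OF z(2) g(1)] by (auto simp: Q_def)
      then show False by linarith
    qed
    ultimately show ?case
      using finZ unfolding same_number_def G_def [symmetric] Z_def [symmetric] by (simp add: card_image)
  qed
qed


section \<open>Zeros near the new pole\<close>

text \<open>This is \<open>harm_zero_ex1\<close> in the coordinate \<open>v\<close> with
  \<open>z = z0 + s v\<close>, where the disk about \<open>u\<close> gets radius
  \<open>\<rho> * s\<close>. The bound \<open>\<rho> \<le> norm u\<close> keeps \<open>z0\<close>
  out of the disk. \<open>s\<close> and \<open>\<epsilon>\<close> are separate because the scale is
  \<open>\<epsilon>\<close> in one application and its square root in the other.\<close>

lemma perturb_zero_scaled:
  assumes s: "s > 0" and \<rho>: "0 < \<rho>" "\<rho> \<le> norm u" and b: "norm b \<noteq> 1"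
    and m: "m = \<bar>norm b - 1\<bar>"
    and an: "\<And>v. v \<in> ball u \<rho> \<Longrightarrow> H analytic_on {z0 + of_real s * v}"
    and der: "\<And>v. v \<in> ball u \<rho> \<Longrightarrow>
      norm (deriv H (z0 + of_real s * v) - of_real \<epsilon> / (of_real s * v)\<^sup>2 - b) \<le> m / 2"
    and small: "norm (H (z0 + of_real s * u) + of_real \<epsilon> / (of_real s * u) - cnj (z0 + of_real s * u))
      < m * (\<rho> * s) / 2"
  shows "\<exists>v\<in>ball u \<rho>. (norm b > 1 \<longrightarrow> z0 + of_real s * v \<in> sp_zeros (perturb H z0 \<epsilon>)) \<and>
    (norm b < 1 \<longrightarrow> z0 + of_real s * v \<in> sr_zeros (perturb H z0 \<epsilon>))"
proof -
  define G where "G = perturb H z0 \<epsilon>"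
  define c where "c = z0 + of_real s * u"
  have scale: "\<exists>v\<in>ball u \<rho>. z = z0 + of_real s * v" if "z \<in> ball c (\<rho> * s)" for z
  proof
    show "z = z0 + of_real s * ((z - z0) / of_real s)" using s by simp
    have "u - (z - z0) / of_real s = (c - z) / of_real s"
      using s by (simp add: c_def field_simps)
    then have "norm (u - (z - z0) / of_real s) = norm (c - z) / s" using s by (simp add: norm_divide)
    moreover have "norm (c - z) / s < \<rho>" using that s by (simp add: dist_norm field_simps)
    ultimately show "(z - z0) / of_real s \<in> ball u \<rho>" by (simp add: dist_norm)
  qed
  have nz: "v \<noteq> 0" if "v \<in> ball u \<rho>" for v using that \<rho> by auto
  have G: "G analytic_on {z}" "norm (deriv G z - b) \<le> m / 2" if z: "z \<in> ball c (\<rho> * s)" for z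
  proof -
    obtain v where v: "v \<in> ball u \<rho>" "z = z0 + of_real s * v" using scale [OF z] by blast
    then have "z \<noteq> z0" using nz s by auto
    then show "G analytic_on {z}" "norm (deriv G z - b) \<le> m / 2"
      using analytic_perturb [of H z z0 \<epsilon>] an [OF v(1)] der [OF v(1)] v(2) by (auto simp: G_def)
  qed
  have "\<exists>!z. z \<in> ball c (\<rho> * s) \<and> G z = cnj z"
  proof (rule harm_zero_ex1 [where H' = "deriv G" and a = b and m = m])
    show "(G has_field_derivative deriv G z) (at z)" if "z \<in> ball c (\<rho> * s)" for z
      using G [OF that] by (intro analytic_derivI) auto
    show "norm (G c - cnj c) < m * (\<rho> * s) / 2"
      using small by (simp add: G_def perturb_def c_def)
  qed (use G s \<rho> b m in auto)
  then obtain z where z: "z \<in> ball c (\<rho> * s)" "G z = cnj z" by blast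
  obtain v where v: "v \<in> ball u \<rho>" "z = z0 + of_real s * v" using scale [OF z(1)] by blast
  have "\<not> is_pole G z" using G(1) [OF z(1)] by (rule analytic_at_imp_not_is_pole)
  moreover have "norm b > 1 \<Longrightarrow> norm (deriv G z) > 1" "norm b < 1 \<Longrightarrow> norm (deriv G z) < 1"
    using G(2) [OF z(1)] sense_of_deriv_near [of "deriv G z" b] by (auto simp: m)
  ultimately show ?thesis
    using v z
    by (intro bexI [of _ v]) (auto simp: G_def harm_zeros_def harm_fun_def sp_zeros_def sr_zeros_def
        sense_preserving_at_def sense_reversing_at_def)
qed

lemma eventually_at_right_scaled_ball:
  fixes u z0 :: complex
  assumes "\<forall>\<^sub>F y in nhds z0. P y"
  shows "\<forall>\<^sub>F s in at_right 0. \<forall>v\<in>ball u \<rho>. P (z0 + of_real s * v)"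
proof -
  obtain d where d: "d > 0" "\<And>y. dist y z0 < d \<Longrightarrow> P y"
    using assms unfolding eventually_nhds_metric by blast
  have "\<forall>\<^sub>F s in at_right 0. s * (norm u + \<rho>) < d"
    using d by (intro eventually_at_right_times_less)
  moreover have "\<forall>\<^sub>F s in at_right (0::real). s > 0" by (rule eventually_at_right_less)
  ultimately show ?thesis
  proof eventually_elim
    case (elim s)
    show ?case
    proof
      fix v assume "v \<in> ball u \<rho>"
      then have "norm v \<le> norm u + \<rho>"
        using norm_triangle_sub [of v u] by (simp add: dist_norm norm_minus_commute)
      then have "s * norm v \<le> s * (norm u + \<rho>)" using elim by (intro mult_left_mono) auto
      then show "P (z0 + of_real s * v)"
        using elim by (intro d(2) le_less_trans [OF _ elim(1)]) (simp add: dist_norm norm_mult)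
    qed
  qed
qed

lemma inverse_square_close:
  fixes u :: complex
  assumes "u \<noteq> 0" "e > 0" "\<rho>0 > 0"
  obtains \<rho> where "0 < \<rho>" "\<rho> \<le> \<rho>0" "\<And>v. v \<in> ball u \<rho> \<Longrightarrow> norm (1 / v\<^sup>2 - 1 / u\<^sup>2) < e"
proof -
  have "isCont (\<lambda>v. 1 / v\<^sup>2) u" using assms by (intro continuous_intros) auto
  then have "\<forall>\<^sub>F v in nhds u. norm (1 / v\<^sup>2 - 1 / u\<^sup>2) < e"
    unfolding dist_norm [symmetric] using assms(2) by (rule isCont_imp_eventually_close)
  then obtain d where d: "d > 0" "\<And>v. dist v u < d \<Longrightarrow> norm (1 / v\<^sup>2 - 1 / u\<^sup>2) < e"
    unfolding eventually_nhds_metric by blast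
  show thesis
    using assms d by (intro that [of "min d \<rho>0"]) (auto simp: dist_commute)
qed

text \<open>With \<open>\<epsilon> = s\<^sup>2\<close> and \<open>z = z0 + s v\<close>, a
  first-order expansion divided by \<open>s\<close> leaves \<open>a v - cnj v + 1 / v\<close> up to
  o(1), and the derivative tends to \<open>a - 1 / v\<^sup>2\<close>. A nonsingular solution
  \<open>u\<close> of the limit equation persists, with its sense given by \<open>b\<close>.\<close>

lemma eventually_zero_near_zero:
  fixes H :: "complex \<Rightarrow> complex"
  assumes an: "H analytic_on {z0}" and z0: "H z0 = cnj z0"
    and u: "u \<noteq> 0" "deriv H z0 * u - cnj u + 1 / u = 0"
    and b: "b = deriv H z0 - 1 / u\<^sup>2" "norm b \<noteq> 1" and r: "r > 0"
  shows "\<forall>\<^sub>F s in at_right 0. \<exists>v\<in>ball u (norm u). let z = z0 + of_real s * v in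
    z \<in> ball z0 r \<and> (norm b > 1 \<longrightarrow> z \<in> sp_zeros (perturb H z0 (s\<^sup>2))) \<and>
    (norm b < 1 \<longrightarrow> z \<in> sr_zeros (perturb H z0 (s\<^sup>2)))"
proof -
  define a where "a = deriv H z0"
  define m where "m = \<bar>norm b - 1\<bar>"
  have m0: "m > 0" using b by (simp add: m_def)
  obtain \<rho> where \<rho>: "0 < \<rho>" "\<rho> \<le> norm u" "\<And>v. v \<in> ball u \<rho> \<Longrightarrow> norm (1 / v\<^sup>2 - 1 / u\<^sup>2) < m / 4"
    using inverse_square_close [of u "m/4" "norm u"] u m0 by auto
  \<comment> \<open>Chosen so that the linearisation error \<open>e * s * norm u\<close> equals
    \<open>m * \<rho> * s / 4\<close>, half of what the contraction allows.\<close>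
  define e where "e = m * \<rho> / (4 * norm u)"
  have e: "e > 0" using m0 \<rho> u by (simp add: e_def)
  have "(H has_field_derivative a) (at z0)" unfolding a_def using an by (intro analytic_derivI)
  then obtain d where d: "d > 0"
    "\<And>y. norm (y - z0) < d \<Longrightarrow> norm (H y - H z0 - a * (y - z0)) \<le> e * norm (y - z0)"
    unfolding has_field_derivative_def has_derivative_at_alt using e by blast
  have "\<forall>\<^sub>F y in nhds z0. norm (H y - H z0 - a * (y - z0)) \<le> e * norm (y - z0)"
    unfolding eventually_nhds_metric using d by (auto simp: dist_norm)
  moreover have "\<forall>\<^sub>F y in nhds z0. H analytic_on {y} \<and> norm (deriv H y - a) < m / 4"
    unfolding a_def using an m0 by (intro eventually_deriv_close) auto
  moreover have "\<forall>\<^sub>F y in nhds z0. y \<in> ball z0 r"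
    using r by (intro eventually_nhds_in_open) auto
  ultimately have "\<forall>\<^sub>F y in nhds z0. (norm (H y - H z0 - a * (y - z0)) \<le> e * norm (y - z0)) \<and>
      H analytic_on {y} \<and> norm (deriv H y - a) < m / 4 \<and> y \<in> ball z0 r"
    by eventually_elim auto
  from eventually_at_right_scaled_ball [OF this, of u \<rho>] eventually_at_right_less [of "0::real"]
  show ?thesis
  proof eventually_elim
    case (elim s)
    have s: "s > 0" by fact
    have P: "H analytic_on {z0 + of_real s * v}" "norm (deriv H (z0 + of_real s * v) - a) < m / 4"
      "z0 + of_real s * v \<in> ball z0 r"
      "norm (H (z0 + of_real s * v) - H z0 - a * (of_real s * v)) \<le> e * norm (of_real s * v)"
      if "v \<in> ball u \<rho>" for v
      using elim(1) that by auto
    have "\<exists>v\<in>ball u \<rho>. (norm b > 1 \<longrightarrow> z0 + of_real s * v \<in> sp_zeros (perturb H z0 (s\<^sup>2))) \<and>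
      (norm b < 1 \<longrightarrow> z0 + of_real s * v \<in> sr_zeros (perturb H z0 (s\<^sup>2)))"
    proof (rule perturb_zero_scaled)
      show "norm (deriv H (z0 + of_real s * v) - of_real (s\<^sup>2) / (of_real s * v)\<^sup>2 - b) \<le> m / 2"
        if v: "v \<in> ball u \<rho>" for v
      proof -
        have "deriv H (z0 + of_real s * v) - of_real (s\<^sup>2) / (of_real s * v)\<^sup>2 - b =
            (deriv H (z0 + of_real s * v) - a) - (1 / v\<^sup>2 - 1 / u\<^sup>2)"
          using s by (simp add: b a_def power_mult_distrib)
        also have "norm \<dots> \<le> norm (deriv H (z0 + of_real s * v) - a) + norm (1 / v\<^sup>2 - 1 / u\<^sup>2)"
          by (rule norm_triangle_ineq4)
        also have "\<dots> \<le> m / 2" using P(2) [OF v] \<rho>(3) [OF v] by simp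
        finally show ?thesis .
      qed
      \<comment> \<open>All terms of order \<open>s\<close> collect into the model equation at
        \<open>u\<close> and cancel, leaving only the linearisation error.\<close>
      have "H (z0 + of_real s * u) + of_real (s\<^sup>2) / (of_real s * u) - cnj (z0 + of_real s * u) =
          (H (z0 + of_real s * u) - H z0 - a * (of_real s * u)) + of_real s * (a * u - cnj u + 1 / u)"
      proof -
        have "of_real (s\<^sup>2) / (of_real s * u) = of_real s * (1 / u)"
          using s by (simp add: power2_eq_square)
        then show ?thesis by (simp only: z0 complex_cnj_add complex_cnj_mult complex_cnj_complex_of_real
              ring_distribs add_ac diff_conv_add_uminus mult_ac) simp
      qed
      also have "\<dots> = H (z0 + of_real s * u) - H z0 - a * (of_real s * u)"
        using u(2) by (simp add: a_def)
      also have "norm \<dots> \<le> e * norm (of_real s * u)" using \<rho> by (intro P) auto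
      also have "\<dots> = m * (\<rho> * s) / 4" using s u by (simp add: e_def norm_mult)
      also have "\<dots> < m * (\<rho> * s) / 2" using s m0 \<rho> by (simp add: field_simps)
      finally show "norm (H (z0 + of_real s * u) + of_real (s\<^sup>2) / (of_real s * u) - cnj (z0 + of_real s * u))
        < m * (\<rho> * s) / 2" .
    qed (fact s \<rho>(1,2) b(2) m_def P(1))+
    then obtain v where v: "v \<in> ball u \<rho>"
      "norm b > 1 \<longrightarrow> z0 + of_real s * v \<in> sp_zeros (perturb H z0 (s\<^sup>2))"
      "norm b < 1 \<longrightarrow> z0 + of_real s * v \<in> sr_zeros (perturb H z0 (s\<^sup>2))" by blast
    show ?case
      using v P(3) [OF v(1)] \<rho>(2) by (intro bexI [of _ v]) (auto simp: Let_def)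
  qed
qed

text \<open>With \<open>z = z0 + s v\<close> and \<open>\<epsilon> = s\<close>, the function tends
  to \<open>harm_fun H z0 + 1 / v\<close>, whose zero is \<open>u\<close>. The derivative is
  dominated by \<open>- 1 / (s u\<^sup>2)\<close>, which is unbounded as \<open>s\<close> tends to
  0, so the zero is sense-preserving.\<close>

lemma eventually_zero_near_nonzero:
  fixes H :: "complex \<Rightarrow> complex"
  assumes an: "H analytic_on {z0}" and nz: "harm_fun H z0 \<noteq> 0" and r: "r > 0"
  shows "\<forall>\<^sub>F s in at_right 0. sp_zeros (perturb H z0 s) \<inter> ball z0 r \<noteq> {}"
proof -
  define u where "u = - (1 / harm_fun H z0)"
  define K where "K = 1 / (norm u)\<^sup>2"
  define M where "M = norm (deriv H z0) + 1"
  have u: "u \<noteq> 0" and uinv: "1 / u = - harm_fun H z0" using nz by (auto simp: u_def)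
  have K: "K > 0" using u by (simp add: K_def)
  obtain \<rho> where \<rho>: "0 < \<rho>" "\<rho> \<le> norm u" "\<And>v. v \<in> ball u \<rho> \<Longrightarrow> norm (1 / v\<^sup>2 - 1 / u\<^sup>2) < K / 8"
    using inverse_square_close [of u "K/8" "norm u"] u K by auto
  have "isCont (harm_fun H) z0"
    unfolding harm_fun_def [abs_def] using analytic_at_imp_isCont [OF an] by (intro continuous_intros)
  then have "\<forall>\<^sub>F y in nhds z0. norm (harm_fun H y - harm_fun H z0) < K * \<rho> / 8"
    using K \<rho> isCont_imp_eventually_close [of z0 "harm_fun H" "K * \<rho> / 8"] by (simp add: dist_norm)
  moreover have "\<forall>\<^sub>F y in nhds z0. H analytic_on {y} \<and> norm (deriv H y - deriv H z0) < 1"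
    using an by (intro eventually_deriv_close) auto
  moreover have "\<forall>\<^sub>F y in nhds z0. y \<in> ball z0 r"
    using r by (intro eventually_nhds_in_open) auto
  ultimately have ev: "\<forall>\<^sub>F y in nhds z0. norm (harm_fun H y - harm_fun H z0) < K * \<rho> / 8 \<and>
      H analytic_on {y} \<and> norm (deriv H y - deriv H z0) < 1 \<and> y \<in> ball z0 r"
    by eventually_elim auto
  \<comment> \<open>The first condition gives \<open>K / s > 2\<close> and
    \<open>K - s \<ge> K / 2\<close>. The second is equivalent to
    \<open>M + K / (8 s) < (K / s - 1) / 2\<close>, the derivative estimate.\<close>
  have evK: "\<forall>\<^sub>F s in at_right 0. s * 1 < K / 2"
    and evM: "\<forall>\<^sub>F s in at_right 0. s * (M + 1 / 2) < 3 * K / 8"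
    by (rule eventually_at_right_times_less; use K in simp)+
  from eventually_at_right_scaled_ball [OF ev, of u \<rho>] eventually_at_right_less [of "0::real"]
    evK evM
  show ?thesis
  proof eventually_elim
    case (elim s)
    have s: "s > 0" by fact
    have P: "H analytic_on {z0 + of_real s * v}" "norm (deriv H (z0 + of_real s * v) - deriv H z0) < 1"
      "z0 + of_real s * v \<in> ball z0 r"
      "norm (harm_fun H (z0 + of_real s * v) - harm_fun H z0) < K * \<rho> / 8"
      if "v \<in> ball u \<rho>" for v
      using elim(1) that by auto
    have sK: "s < K / 2" and sM: "s * (M + 1 / 2) < 3 * K / 8" using elim K by auto
    define b where "b = - (1 / (of_real s * u\<^sup>2))"
    \<comment> \<open>\<open>m\<close> grows like \<open>1 / s\<close> and cancels the factor
      \<open>s\<close> of the radius: \<open>m * (\<rho> * s) / 2 = (K - s) * \<rho> / 2\<close>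
      does not shrink with \<open>s\<close>, so mere continuity of \<open>harm_fun H\<close> at
      \<open>z0\<close> suffices for the value estimate.\<close>
    define m where "m = K / s - 1"
    have nb: "norm b = K / s" using s by (simp add: b_def K_def norm_divide norm_mult norm_power)
    have b1: "norm b > 1" unfolding nb using sK s K by (simp add: field_simps)
    have "\<exists>v\<in>ball u \<rho>. (norm b > 1 \<longrightarrow> z0 + of_real s * v \<in> sp_zeros (perturb H z0 s)) \<and>
      (norm b < 1 \<longrightarrow> z0 + of_real s * v \<in> sr_zeros (perturb H z0 s))"
    proof (rule perturb_zero_scaled)
      show "norm (deriv H (z0 + of_real s * v) - of_real s / (of_real s * v)\<^sup>2 - b) \<le> m / 2"
        if v: "v \<in> ball u \<rho>" for v
      proof -
        have "deriv H (z0 + of_real s * v) - of_real s / (of_real s * v)\<^sup>2 - b =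
            deriv H (z0 + of_real s * v) - (1 / v\<^sup>2 - 1 / u\<^sup>2) / of_real s"
          using s by (simp add: b_def power2_eq_square diff_divide_distrib mult_ac)
        also have "norm \<dots> \<le> norm (deriv H (z0 + of_real s * v)) + norm (1 / v\<^sup>2 - 1 / u\<^sup>2) / s"
          using norm_triangle_ineq4 [of "deriv H (z0 + of_real s * v)" "(1 / v\<^sup>2 - 1 / u\<^sup>2) / of_real s"] s
          by (simp add: norm_divide)
        also have "norm (deriv H (z0 + of_real s * v)) \<le> M"
          using P(2) [OF v] norm_triangle_sub [of "deriv H (z0 + of_real s * v)" "deriv H z0"]
          by (simp add: M_def)
        also have "norm (1 / v\<^sup>2 - 1 / u\<^sup>2) / s \<le> (K / 8) / s"
          using \<rho>(3) [OF v] s by (intro divide_right_mono) auto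
        also have "M + (K / 8) / s \<le> m / 2"
        proof -
          have "M + 1 / 2 \<le> (3 * K / 8) / s" 
            unfolding pos_le_divide_eq [OF s] using sM by (simp only: mult.commute)
          also have "\<dots> = 3 / 8 * (K / s)" by simp
          finally show ?thesis by (simp add: m_def diff_divide_distrib)
        qed
        finally show ?thesis by simp
      qed
      have "H (z0 + of_real s * u) + of_real s / (of_real s * u) - cnj (z0 + of_real s * u) =
          harm_fun H (z0 + of_real s * u) + 1 / u"
        using s by (simp add: harm_fun_def)
      also have "\<dots> = harm_fun H (z0 + of_real s * u) - harm_fun H z0" by (simp add: uinv)
      also have "norm \<dots> < K * \<rho> / 8" using \<rho> by (intro P) auto
      also have "K * \<rho> / 8 \<le> (K / 2) * \<rho> / 2" using K \<rho> by (simp add: field_simps)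
      also have "\<dots> \<le> (K - s) * \<rho> / 2" using sK \<rho> by (intro divide_right_mono mult_right_mono) auto
      also have "\<dots> = m * (\<rho> * s) / 2" using s by (simp add: m_def field_simps)
      finally show "norm (H (z0 + of_real s * u) + of_real s / (of_real s * u) - cnj (z0 + of_real s * u))
        < m * (\<rho> * s) / 2" .
      show "m = \<bar>norm b - 1\<bar>" using b1 by (simp add: m_def nb)
      show "norm b \<noteq> 1" using b1 by simp
    qed (fact s \<rho>(1,2) P(1))+
    then obtain v where v: "v \<in> ball u \<rho>" "z0 + of_real s * v \<in> sp_zeros (perturb H z0 s)"
      using b1 by blast
    show ?case using v(2) P(3) [OF v(1)] by blast
  qed
qed

section \<open>The model equation and the pairs of zeros it produces\<close>

text \<open>With \<open>t = |u|\<^sup>2\<close>, the equation \<open>a u - cnj u + 1 / u = 0\<close> says \<open>a u\<^sup>2 = t - 1\<close>; so \<open>a u\<^sup>2\<close> is real,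
  and \<open>\<sigma>\<close> records the sign of \<open>1 - t\<close>.\<close>

lemma model_equation_solution:
  fixes a :: complex and \<sigma> :: real
  assumes a: "a \<noteq> 0" and \<sigma>: "\<sigma> = 1 \<or> \<sigma> = -1" "1 + \<sigma> * norm a > 0"
  obtains u where "u \<noteq> 0" "a * u - cnj u + 1 / u = 0" "norm (a - 1 / u\<^sup>2) = \<bar>2 * norm a + \<sigma>\<bar>"
proof -
  define n where "n = norm a"
  have n: "n > 0" "1 + \<sigma> * n > 0" using a \<sigma> by (auto simp: n_def)
  \<comment> \<open>\<open>d\<close> is \<open>1 - t\<close>. Since \<open>a w = - d\<close>, the
    requirement \<open>|w| = t\<close> reads \<open>|d| = n * (1 - d)\<close>, and this is its
    solution of sign \<sigma>.\<close>
  define d where "d = \<sigma> * n / (1 + \<sigma> * n)"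
  define w where "w = - of_real d / a"
  define u where "u = csqrt w"
  have d0: "d \<noteq> 0" using n \<sigma> by (auto simp: d_def)
  have d1: "1 / (1 + \<sigma> * n) = 1 - d"
    using n unfolding d_def by (simp add: eq_diff_eq add_divide_distrib [symmetric])
  have d2: "n / d = 1 / \<sigma> + n"
    using n \<sigma>(1) unfolding d_def by (auto simp: field_simps)
  have u2: "u\<^sup>2 = w" by (simp add: u_def)
  have w0: "w \<noteq> 0" using a d0 by (simp add: w_def)
  then have u0: "u \<noteq> 0" using u2 by auto
  have aw: "a * w = - of_real d" using a by (simp add: w_def)
  have "norm w = \<bar>d\<bar> / n" unfolding w_def by (simp add: norm_divide n_def)
  also have "\<bar>d\<bar> = n / (1 + \<sigma> * n)" using n \<sigma>(1) unfolding d_def by auto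
  also have "\<dots> / n = 1 - d" using n d1 by simp
  finally have "norm w = 1 - d" .
  then have uu: "u * cnj u = of_real (1 - d)"
    by (metis complex_norm_square norm_power u2 of_real_power)
  have "u * (a * u - cnj u + 1 / u) = a * w - u * cnj u + 1"
    using u0 by (simp add: u2 [symmetric] algebra_simps power2_eq_square)
  also have "\<dots> = 0" unfolding aw uu by simp
  finally have eq: "a * u - cnj u + 1 / u = 0" using u0 by simp
  \<comment> \<open>Here \<open>1 / u\<^sup>2 = - a / d\<close>, so the derivative is a real
    multiple of \<open>a\<close>. Its modulus then follows from
    \<open>n / d = 1 / \<sigma> + n\<close> and \<open>1 / \<sigma> = \<sigma>\<close>.\<close>
  have "a - 1 / u\<^sup>2 = a * of_real (1 + 1 / d)"
    using a d0 unfolding u2 w_def by (simp add: algebra_simps)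
  also have "norm \<dots> = n * \<bar>1 + 1 / d\<bar>"
    unfolding norm_mult norm_of_real n_def ..
  also have "\<dots> = \<bar>n * (1 + 1 / d)\<bar>" using n by (simp add: abs_mult)
  also have "n * (1 + 1 / d) = 2 * n + \<sigma>"
    using d2 \<sigma>(1) by (auto simp: distrib_left)
  finally show thesis using that [OF u0 eq] by (simp add: n_def)
qed

text \<open>The model equation and \<open>1 / u\<^sup>2\<close> are unchanged when \<open>u\<close>
  becomes \<open>- u\<close>, so both signs give a zero of the same sense. The open disks of radius
  \<open>norm u\<close> about \<open>u\<close> and \<open>- u\<close> are disjoint, hence the zeros
  are distinct.\<close>

lemma eventually_two_zeros_near_zero:
  fixes H :: "complex \<Rightarrow> complex"
  assumes an: "H analytic_on {z0}" and z0: "H z0 = cnj z0"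
    and u: "u \<noteq> 0" "deriv H z0 * u - cnj u + 1 / u = 0"
    and b: "norm (deriv H z0 - 1 / u\<^sup>2) \<noteq> 1" and r: "r > 0"
  shows "\<forall>\<^sub>F \<epsilon> in at_right 0. \<exists>z z'. z \<noteq> z' \<and> {z, z'} \<subseteq>
    (if norm (deriv H z0 - 1 / u\<^sup>2) > 1 then sp_zeros else sr_zeros) (perturb H z0 \<epsilon>) \<inter> ball z0 r"
proof -
  define b where "b = deriv H z0 - 1 / u\<^sup>2"
  define X where "X = (if norm b > 1 then sp_zeros else sr_zeros)"
  have nb: "norm b \<noteq> 1" using assms(5) by (simp add: b_def)
  have ev: "\<forall>\<^sub>F s in at_right 0. \<exists>v\<in>ball w (norm w). z0 + of_real s * v \<in> X (perturb H z0 (s\<^sup>2)) \<inter> ball z0 r"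
    if "w = u \<or> w = - u" for w
  proof -
    have w: "w \<noteq> 0" "deriv H z0 * w - cnj w + 1 / w = 0" "b = deriv H z0 - 1 / w\<^sup>2"
      using that u by (auto simp: b_def algebra_simps add_eq_0_iff)
    show ?thesis
      using eventually_zero_near_zero [OF an z0 w nb r]
      by eventually_elim (use nb in \<open>auto simp: Let_def X_def\<close>)
  qed
  have "\<forall>\<^sub>F s in at_right (0::real). \<exists>z z'. z \<noteq> z' \<and> {z, z'} \<subseteq> X (perturb H z0 (s\<^sup>2)) \<inter> ball z0 r"
    using ev [OF disjI1 [OF refl]] ev [OF disjI2 [OF refl]] eventually_at_right_less [of "0::real"]
  proof eventually_elim
    case (elim s)
    then obtain v v' where v: "v \<in> ball u (norm u)" "v' \<in> ball (- u) (norm u)"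
      "z0 + of_real s * v \<in> X (perturb H z0 (s\<^sup>2)) \<inter> ball z0 r"
      "z0 + of_real s * v' \<in> X (perturb H z0 (s\<^sup>2)) \<inter> ball z0 r" by auto
    have "v \<noteq> v'"
    proof
      assume "v = v'"
      then have "dist u v < norm u" "dist (- u) v < norm u" using v(1,2) by auto
      then have "dist u (- u) < norm u + norm u" by (rule dist_triangle_less_add)
      moreover have "dist u (- u) = norm u + norm u"
        by (simp add: dist_norm flip: mult_2)
      ultimately show False by simp
    qed
    then show ?case
      using v elim(3) by (intro exI [of _ "z0 + of_real s * v"] exI [of _ "z0 + of_real s * v'"]) auto
  qed
  \<comment> \<open>Substituting \<open>s = sqrt \<epsilon>\<close> returns from the length scale to
    the perturbation parameter.\<close>
  moreover have "filterlim sqrt (at_right 0) (at_right 0)"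
    unfolding filterlim_at
    using eventually_at_right_less [of "0::real"] tendsto_real_sqrt [OF tendsto_ident_at, of 0 "{0<..}"]
    by (auto elim!: eventually_mono)
  ultimately have "\<forall>\<^sub>F \<epsilon> in at_right (0::real). \<exists>z z'. z \<noteq> z' \<and> {z, z'} \<subseteq> X (perturb H z0 ((sqrt \<epsilon>)\<^sup>2)) \<inter> ball z0 r"
    by (rule eventually_compose_filterlim)
  then show ?thesis
    using eventually_at_right_less [of "0::real"]
    unfolding b_def [symmetric] X_def [symmetric] by eventually_elim simp
qed

section \<open>Finiteness of the zero set after the perturbation\<close>

lemma is_pole_perturb_center:
  assumes "H analytic_on {z0}" "\<epsilon> \<noteq> 0"
  shows "is_pole (perturb H z0 \<epsilon>) z0"
proof -
  have "is_pole (\<lambda>z. of_real \<epsilon> / (z - z0)) z0"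
    using assms(2)
    by (intro is_pole_divide filterlim_atI) (auto intro!: tendsto_eq_intros simp: eventually_at_filter)
  moreover have "H \<midarrow>z0\<rightarrow> H z0"
    using analytic_at_imp_isCont [OF assms(1)] by (simp add: isCont_def)
  ultimately show ?thesis
    unfolding is_pole_def perturb_def [abs_def] by (intro tendsto_add_filterlim_at_infinity)
qed

text \<open>Lower bounds on \<open>card\<close> are meaningful only for finite sets. The perturbed
  function falls under \<open>finite_harm_zeros\<close> because the perturbation adds just one pole,
  at \<open>z0\<close>.\<close>

lemma finite_harm_zeros_perturb:
  assumes H: "pole_or_analytic H" and inf: "filterlim (harm_fun H) at_infinity at_infinity"
    and z0: "H analytic_on {z0}" and \<epsilon>: "\<epsilon> \<noteq> 0" and reg: "harm_regular (perturb H z0 \<epsilon>)"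
  shows "finite (harm_zeros (perturb H z0 \<epsilon>))"
proof (rule finite_harm_zeros [OF _ reg filterlim_harm_fun_perturb [OF inf]])
  show "pole_or_analytic (perturb H z0 \<epsilon>)"
    unfolding pole_or_analytic_def
  proof
    fix z show "is_pole (perturb H z0 \<epsilon>) z \<or> perturb H z0 \<epsilon> analytic_on {z}"
      using H is_pole_perturb [of z z0 H \<epsilon>] analytic_perturb(1) [of H z z0 \<epsilon>]
        is_pole_perturb_center [OF z0 \<epsilon>]
      unfolding pole_or_analytic_def by (cases "z = z0") auto
  qed
qed

section \<open>Rational functions\<close>

lemma eventually_poly_nonzero:
  fixes q :: "complex poly"
  assumes "q \<noteq> 0" shows "\<forall>\<^sub>F w in at z. poly q w \<noteq> 0"
  using islimpt_finite [OF poly_roots_finite [OF assms]] by (simp add: islimpt_iff_eventually)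

text \<open>Coprimality excludes common roots, so no root of \<open>q\<close> is a removable
  singularity.\<close>

lemma rational_pole_or_analytic:
  fixes p q :: "complex poly"
  assumes "coprime p q" "q \<noteq> 0"
  shows "is_pole (\<lambda>z. poly p z / poly q z) z \<longleftrightarrow> poly q z = 0"
    and "pole_or_analytic (\<lambda>z. poly p z / poly q z)"
proof -
  have pole: "is_pole (\<lambda>z. poly p z / poly q z) z" if "poly q z = 0" for z
  proof (rule is_pole_divide)
    have "\<forall>\<^sub>F w in at z. poly q w \<noteq> 0"
      using assms(2) by (rule eventually_poly_nonzero)
    moreover have "poly q \<midarrow>z\<rightarrow> poly q z" by (rule poly_isCont [unfolded isCont_def])
    ultimately show "filterlim (poly q) (at 0) (at z)"
      using that by (intro filterlim_atI) auto
    show "poly p z \<noteq> 0"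
      using assms that coprime_poly_0 [of p q z] by blast
  qed auto
  have "poly f analytic_on {z}" for f :: "complex poly" and z
    unfolding analytic_at using poly_holomorphic_on [OF holomorphic_on_ident, of f UNIV] by blast
  then have an: "(\<lambda>z. poly p z / poly q z) analytic_on {z}" if "poly q z \<noteq> 0" for z
    using that by (intro analytic_on_divide) auto
  show "is_pole (\<lambda>z. poly p z / poly q z) z \<longleftrightarrow> poly q z = 0"
    using pole an analytic_at_imp_not_is_pole by blast
  show "pole_or_analytic (\<lambda>z. poly p z / poly q z)"
    using pole an unfolding pole_or_analytic_def by blast
qed

text \<open>Splitting off one factor \<open>z - z0\<close> from \<open>q\<close> leaves
  \<open>p / q1\<close>, with \<open>p\<close> nonzero at \<open>z0\<close> and \<open>q1\<close>
  bounded nearby. A higher-order pole, where \<open>q1\<close> vanishes too, needs no separate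
  treatment.\<close>

lemma rational_pole_lower_bound:
  fixes p q :: "complex poly"
  assumes "coprime p q" "q \<noteq> 0" "poly q z0 = 0"
  obtains C where "C > 0" "\<forall>\<^sub>F z in at z0. C \<le> norm (poly p z / poly q z) * norm (z - z0)"
proof -
  obtain q1 where q1: "q = [:- z0, 1:] * q1"
    using assms(3) by (auto simp: poly_eq_0_iff_dvd elim: dvdE)
  have p0: "poly p z0 \<noteq> 0"
    using assms coprime_poly_0 [of p q z0] by blast
  define B where "B = norm (poly q1 z0) + 1"
  define C where "C = norm (poly p z0) / 2 / B"
  have B: "B > 0" using norm_ge_zero [of "poly q1 z0"] unfolding B_def by linarith
  have "(\<lambda>z. norm (poly f z)) \<midarrow>z0\<rightarrow> norm (poly f z0)" for f
    by (intro tendsto_norm poly_isCont [unfolded isCont_def])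
  then have "\<forall>\<^sub>F z in at z0. norm (poly p z) > norm (poly p z0) / 2"
    and "\<forall>\<^sub>F z in at z0. norm (poly q1 z) < B"
    by (rule order_tendstoD; use p0 in \<open>simp add: B_def\<close>)+
  moreover have "\<forall>\<^sub>F z in at z0. poly q z \<noteq> 0"
    using assms(2) by (rule eventually_poly_nonzero)
  ultimately have "\<forall>\<^sub>F z in at z0. C \<le> norm (poly p z / poly q z) * norm (z - z0)"
  proof eventually_elim
    case (elim z)
    have nz: "poly q1 z \<noteq> 0" "z \<noteq> z0" using elim(3) by (auto simp: q1)
    have "poly q z = (z - z0) * poly q1 z" by (simp add: q1 algebra_simps)
    then have "poly p z / poly q z * (z - z0) = poly p z / poly q1 z"
      using nz by simp
    then have "norm (poly p z / poly q z) * norm (z - z0) = norm (poly p z) / norm (poly q1 z)"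
      by (metis norm_divide norm_mult)
    moreover have "C \<le> norm (poly p z) / norm (poly q1 z)"
      unfolding C_def using elim nz B by (intro frac_le) auto
    ultimately show ?case by simp
  qed
  moreover have "C > 0" using p0 B by (simp add: C_def)
  ultimately show thesis using that by blast
qed

text \<open>For \<open>\<epsilon> \<le> C / 2\<close> the perturbation has at most half the modulus
  of \<open>R\<close> near \<open>z0\<close>, so the sum still outgrows \<open>norm z\<close> on a
  disk independent of \<epsilon>.\<close>

lemma eventually_no_zero_near_pole:
  fixes R :: "complex \<Rightarrow> complex"
  assumes pole: "is_pole R z0" and C: "C > 0" "\<forall>\<^sub>F z in at z0. C \<le> norm (R z) * norm (z - z0)"
  obtains d where "d > 0" "\<forall>\<^sub>F \<epsilon> in at_right 0. harm_zeros (perturb R z0 \<epsilon>) \<inter> ball z0 d = {}"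
proof -
  have lim: "\<forall>\<^sub>F z in at z0. t \<le> norm (R z)" if "t > 0" for t
    using pole that unfolding is_pole_def filterlim_at_infinity [OF order_refl] by blast
  \<comment> \<open>On a disk of radius at most 1,
    \<open>norm z \<le> norm z0 + 1 < t / 2\<close>.\<close>
  define t where "t = 2 * (norm z0 + 1) + 2"
  have "t > 0" unfolding t_def by (intro add_nonneg_pos) auto
  obtain d1 where d1: "d1 > 0"
    "\<And>z. z \<noteq> z0 \<Longrightarrow> dist z z0 < d1 \<Longrightarrow> C \<le> norm (R z) * norm (z - z0) \<and> t \<le> norm (R z)"
    using eventually_conj [OF C(2) lim [OF \<open>t > 0\<close>]] unfolding eventually_at by blast
  define d where "d = min d1 1"
  have half: "norm (R z) / 2 \<le> norm (perturb R z0 \<epsilon> z)"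
    if z: "z \<noteq> z0" "dist z z0 < d" and \<epsilon>: "0 < \<epsilon>" "\<epsilon> \<le> C / 2" for \<epsilon> z
  proof -
    have "\<epsilon> \<le> norm (R z) / 2 * norm (z - z0)" using d1(2) [OF z(1)] z(2) \<epsilon> by (simp add: d_def)
    then have "norm (of_real \<epsilon> / (z - z0)) \<le> norm (R z) / 2"
      using z(1) \<epsilon> by (simp add: norm_divide pos_divide_le_eq)
    moreover have "norm (R z) \<le> norm (perturb R z0 \<epsilon> z) + norm (of_real \<epsilon> / (z - z0))"
      using norm_triangle_ineq4 [of "perturb R z0 \<epsilon> z" "of_real \<epsilon> / (z - z0)"] by (simp add: perturb_def)
    ultimately show ?thesis by simp
  qed
  have d: "d > 0" using d1 by (simp add: d_def)
  have "\<forall>\<^sub>F \<epsilon> in at_right 0. \<epsilon> * 1 < C / 2" using C by (intro eventually_at_right_times_less) auto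
  moreover have "\<forall>\<^sub>F \<epsilon> in at_right (0::real). \<epsilon> > 0" by (rule eventually_at_right_less)
  ultimately have "\<forall>\<^sub>F \<epsilon> in at_right 0. harm_zeros (perturb R z0 \<epsilon>) \<inter> ball z0 d = {}"
  proof eventually_elim
    case (elim \<epsilon>)
    \<comment> \<open>The point \<open>z0\<close> itself needs care: the bound on \<epsilon>
      excludes cancellation of a simple pole with residue \<open>- \<epsilon>\<close>.\<close>
    have pole_G: "is_pole (perturb R z0 \<epsilon>) z0"
      unfolding is_pole_def filterlim_at_infinity [OF order_refl]
    proof (intro allI impI)
      fix s :: real assume "s > 0"
      have "\<forall>\<^sub>F z in at z0. z \<noteq> z0 \<and> dist z z0 < d"
        unfolding eventually_at using d by blast
      moreover have "\<forall>\<^sub>F z in at z0. 2 * s \<le> norm (R z)" using \<open>s > 0\<close> by (intro lim) auto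
      ultimately show "\<forall>\<^sub>F z in at z0. s \<le> norm (perturb R z0 \<epsilon> z)"
      proof eventually_elim
        case (elim z)
        then show ?case using half [of z \<epsilon>] \<open>\<epsilon> > 0\<close> \<open>\<epsilon> * 1 < C / 2\<close> by linarith
      qed
    qed
    have "z \<notin> harm_zeros (perturb R z0 \<epsilon>)" if z: "z \<in> ball z0 d" "z \<noteq> z0" for z
    proof
      assume "z \<in> harm_zeros (perturb R z0 \<epsilon>)"
      then have "norm (perturb R z0 \<epsilon> z) = norm z" by (simp add: harm_zeros_def harm_fun_def)
      moreover have "norm z \<le> norm z0 + 1"
        using z norm_triangle_sub [of z z0] by (simp add: d_def dist_norm norm_minus_commute)
      moreover have "t \<le> norm (R z)" using d1(2) [OF z(2)] z(1) by (simp add: d_def dist_commute)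
      moreover have "norm (R z) / 2 \<le> norm (perturb R z0 \<epsilon> z)"
        using z elim by (intro half) (auto simp: dist_commute)
      ultimately show False by (simp add: t_def)
    qed
    moreover have "z0 \<notin> harm_zeros (perturb R z0 \<epsilon>)" using pole_G by (simp add: harm_zeros_def)
    ultimately show ?case by blast
  qed
  with d show thesis by (rule that)
qed

section \<open>Assembling the cases\<close>

lemma card_ge_2I: "finite A \<Longrightarrow> z \<noteq> z' \<Longrightarrow> {z, z'} \<subseteq> A \<Longrightarrow> card A \<ge> 2"
  using card_mono [of A "{z, z'}"] by simp

theorem theorem3p14:
  fixes p q :: "complex poly" and R :: "complex \<Rightarrow> complex" and z0 :: complex
  assumes "coprime p q" and "q \<noteq> 0"
    and "R = (\<lambda>z. poly p z / poly q z)"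
    and "max (degree p) (degree q) \<ge> 2"
    and "harm_regular R"
    and "filterlim (harm_fun R) at_infinity at_infinity"
  shows "\<forall>\<^sub>F \<epsilon> in at_right (0::real).
    (let G = perturb R z0 \<epsilon> in harm_regular G \<longrightarrow>
      (is_pole R z0 \<longrightarrow> same_number (harm_zeros G) (harm_zeros R)) \<and>
      (\<not> is_pole R z0 \<and> harm_fun R z0 \<noteq> 0 \<longrightarrow>
        (\<exists>r>0. (\<forall>z \<in> ball z0 r. \<not> is_pole R z \<and> harm_fun R z \<noteq> 0) \<and>
          card (sp_zeros G \<inter> ball z0 r) \<ge> 1 \<and>
          same_number (harm_zeros G - ball z0 r) (harm_zeros R - ball z0 r))) \<and>
      (z0 \<in> harm_zeros R \<and> norm (deriv R z0) > 1 \<longrightarrow>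
        (\<exists>r>0. card (sp_zeros G \<inter> ball z0 r) \<ge> 2 \<and>
          same_number (harm_zeros G - ball z0 r) (harm_zeros R - ball z0 r))) \<and>
      (z0 \<in> harm_zeros R \<and> 0 < norm (deriv R z0) \<and> norm (deriv R z0) < 1 \<longrightarrow>
        (\<exists>r>0. card (sp_zeros G \<inter> ball z0 r) \<ge> 2 \<and>
          card (sr_zeros G \<inter> ball z0 r) \<ge> 2 \<and>
          same_number (harm_zeros G - ball z0 r) (harm_zeros R - ball z0 r))))"
proof -
  note pa = rational_pole_or_analytic(2) [OF assms(1,2), folded assms(3)]
  note reg = assms(5) and inf = assms(6)
  have iso: "\<forall>\<^sub>F y in nhds z0. y \<noteq> z0 \<longrightarrow> y \<notin> harm_zeros R"
    using isolated_harm_zeros [OF pa reg, of z0] by (simp add: eventually_at_filter)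
  \<comment> \<open>The doubled radius keeps the sphere of radius \<open>r\<close> free of
    zeros.\<close>
  have outside: "\<forall>\<^sub>F \<epsilon> in at_right 0.
      same_number (harm_zeros (perturb R z0 \<epsilon>) - ball z0 r) (harm_zeros R - ball z0 r)"
    if "0 < r" "\<forall>y\<in>ball z0 (2 * r). y \<noteq> z0 \<longrightarrow> y \<notin> harm_zeros R" for r
    using that by (intro eventually_same_number_outside_ball pa reg inf) force+
  show ?thesis
  proof (cases "is_pole R z0")
    case True
    have "poly q z0 = 0" using True rational_pole_or_analytic(1) [OF assms(1,2)] assms(3) by simp
    then obtain C where "C > 0" "\<forall>\<^sub>F z in at z0. C \<le> norm (R z) * norm (z - z0)"
      using rational_pole_lower_bound [OF assms(1,2)] unfolding assms(3) by blast
    then obtain d where d: "d > 0" "\<forall>\<^sub>F \<epsilon> in at_right 0. harm_zeros (perturb R z0 \<epsilon>) \<inter> ball z0 d = {}"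
      using eventually_no_zero_near_pole [OF True] by blast
    obtain d' where d': "d' > 0" "\<And>y. dist y z0 < d' \<Longrightarrow> y \<noteq> z0 \<Longrightarrow> y \<notin> harm_zeros R"
      using iso unfolding eventually_nhds_metric by blast
    \<comment> \<open>The ball of radius \<open>r\<close> contains no zeros of either function, so
      the counts outside it are the total counts.\<close>
    define r where "r = min d (d' / 2)"
    have r: "r > 0" "r \<le> d" "2 * r \<le> d'" using d d' by (auto simp: r_def)
    have none: "harm_zeros R \<inter> ball z0 r = {}"
      using d' r True by (force simp: harm_zeros_def dist_commute)
    have "\<forall>\<^sub>F \<epsilon> in at_right 0.
      same_number (harm_zeros (perturb R z0 \<epsilon>) - ball z0 r) (harm_zeros R - ball z0 r)"
      using r d' by (intro outside) (auto simp: dist_commute)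
    moreover note d(2)
    ultimately have "\<forall>\<^sub>F \<epsilon> in at_right 0. same_number (harm_zeros (perturb R z0 \<epsilon>)) (harm_zeros R)"
    proof eventually_elim
      case (elim \<epsilon>)
      have "harm_zeros (perturb R z0 \<epsilon>) \<inter> ball z0 r = {}"
        using elim(2) subset_ball [OF r(2), of z0] by blast
      then show ?case using elim(1) none by (simp add: Diff_triv)
    qed
    then show ?thesis
      by eventually_elim (use True in \<open>auto simp: Let_def harm_zeros_def\<close>)
  next
    case False
    then have an: "R analytic_on {z0}" using pole_or_analytic_iff [OF pa] by blast
    define good where "good y \<longleftrightarrow> (y \<noteq> z0 \<longrightarrow> y \<notin> harm_zeros R) \<and> \<not> is_pole R y" for y
    have "\<forall>\<^sub>F y in nhds z0. R analytic_on {y} \<and> norm (deriv R y - deriv R z0) < 1"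
      using an by (intro eventually_deriv_close) auto
    with iso have "\<forall>\<^sub>F y in nhds z0. good y"
      by eventually_elim (auto simp: good_def analytic_at_imp_not_is_pole)
    then obtain d where d: "d > 0" "\<And>y. dist y z0 < d \<Longrightarrow> good y"
      unfolding eventually_nhds_metric by blast
    define r where "r = d / 2"
    have r: "r > 0" "\<And>y. y \<in> ball z0 (2 * r) \<Longrightarrow> good y" using d by (auto simp: r_def dist_commute)
    have fin: "\<forall>\<^sub>F \<epsilon> in at_right 0. harm_regular (perturb R z0 \<epsilon>) \<longrightarrow> finite (harm_zeros (perturb R z0 \<epsilon>))"
      using eventually_at_right_less [of "0::real"]
      by eventually_elim (use finite_harm_zeros_perturb [OF pa inf an] in auto)
    have out: "\<forall>\<^sub>F \<epsilon> in at_right 0.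
      same_number (harm_zeros (perturb R z0 \<epsilon>) - ball z0 r) (harm_zeros R - ball z0 r)"
      using r by (intro outside) (auto simp: good_def)
    \<comment> \<open>For \<open>\<sigma> = 1\<close> the modulus \<open>2|a| + 1\<close> exceeds 1,
      giving sense-preserving zeros. For \<open>\<sigma> = -1\<close>, possible only if
      \<open>|a| < 1\<close>, the modulus \<open>|2|a| - 1|\<close> is below 1, giving
      sense-reversing ones.\<close>
    have two: "\<forall>\<^sub>F \<epsilon> in at_right 0. \<exists>z z'. z \<noteq> z' \<and> {z, z'} \<subseteq>
        (if \<bar>2 * norm (deriv R z0) + \<sigma>\<bar> > 1 then sp_zeros else sr_zeros) (perturb R z0 \<epsilon>) \<inter> ball z0 r"
      if *: "z0 \<in> harm_zeros R" "deriv R z0 \<noteq> 0" "\<sigma> = 1 \<or> \<sigma> = -1" "1 + \<sigma> * norm (deriv R z0) > 0" for \<sigma>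
    proof -
      obtain u where u: "u \<noteq> 0" "deriv R z0 * u - cnj u + 1 / u = 0"
        "norm (deriv R z0 - 1 / u\<^sup>2) = \<bar>2 * norm (deriv R z0) + \<sigma>\<bar>"
        using model_equation_solution [OF *(2-4)] by blast
      have "norm (deriv R z0 - 1 / u\<^sup>2) \<noteq> 1" using u(3) *(2-4) by (auto simp: abs_if split: if_splits)
      moreover have "R z0 = cnj z0" using *(1) by (simp add: harm_zeros_def harm_fun_def)
      ultimately show ?thesis
        using eventually_two_zeros_near_zero [OF an _ u(1,2) _ r(1)] u(3) by simp
    qed
    show ?thesis
    proof (cases "z0 \<in> harm_zeros R")
      case True
      show ?thesis
      \<comment> \<open>At a zero with vanishing derivative none of the four items applies.\<close>
      proof (cases "deriv R z0 = 0")
        case False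
        have sp: "\<forall>\<^sub>F \<epsilon> in at_right 0. \<exists>z z'. z \<noteq> z' \<and> {z, z'} \<subseteq> sp_zeros (perturb R z0 \<epsilon>) \<inter> ball z0 r"
          using two [OF True False, of 1] False by (simp add: add_nonneg_pos)
        have sr: "\<forall>\<^sub>F \<epsilon> in at_right 0. norm (deriv R z0) < 1 \<longrightarrow>
            (\<exists>z z'. z \<noteq> z' \<and> {z, z'} \<subseteq> sr_zeros (perturb R z0 \<epsilon>) \<inter> ball z0 r)"
        proof (cases "norm (deriv R z0) < 1")
          case 1: True
          then have "\<not> \<bar>2 * norm (deriv R z0) + (-1)\<bar> > 1" by (simp add: abs_if)
          then show ?thesis using two [OF True False, of "-1"] 1 by simp
        qed simp
        from fin out sp sr show ?thesis
        proof eventually_elim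
          case (elim \<epsilon>)
          show ?case
            unfolding Let_def
          proof (intro impI conjI)
            assume "harm_regular (perturb R z0 \<epsilon>)"
            then have "finite (harm_zeros (perturb R z0 \<epsilon>))" using elim(1) by blast
            then have fins: "finite (sp_zeros (perturb R z0 \<epsilon>) \<inter> ball z0 r)"
              "finite (sr_zeros (perturb R z0 \<epsilon>) \<inter> ball z0 r)"
              by (auto simp: sp_zeros_def sr_zeros_def)
            have c: "card (sp_zeros (perturb R z0 \<epsilon>) \<inter> ball z0 r) \<ge> 2"
              using elim(3) card_ge_2I [OF fins(1)] by blast
            show "\<exists>r>0. card (sp_zeros (perturb R z0 \<epsilon>) \<inter> ball z0 r) \<ge> 2 \<and>
              same_number (harm_zeros (perturb R z0 \<epsilon>) - ball z0 r) (harm_zeros R - ball z0 r)"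
              using c elim(2) r(1) by blast
            assume "z0 \<in> harm_zeros R \<and> 0 < norm (deriv R z0) \<and> norm (deriv R z0) < 1"
            then have "card (sr_zeros (perturb R z0 \<epsilon>) \<inter> ball z0 r) \<ge> 2"
              using elim(4) card_ge_2I [OF fins(2)] by blast
            then show "\<exists>r>0. card (sp_zeros (perturb R z0 \<epsilon>) \<inter> ball z0 r) \<ge> 2 \<and>
              card (sr_zeros (perturb R z0 \<epsilon>) \<inter> ball z0 r) \<ge> 2 \<and>
              same_number (harm_zeros (perturb R z0 \<epsilon>) - ball z0 r) (harm_zeros R - ball z0 r)"
              using c elim(2) r(1) by blast
          qed (use True \<open>\<not> is_pole R z0\<close> in \<open>auto simp: harm_zeros_def\<close>)
        qed
      qed (use True \<open>\<not> is_pole R z0\<close> in \<open>simp add: harm_zeros_def\<close>)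
    next
      case nonzero: False
      then have nz: "harm_fun R z0 \<noteq> 0" using False by (simp add: harm_zeros_def)
      have nz_ball: "\<forall>z\<in>ball z0 r. \<not> is_pole R z \<and> harm_fun R z \<noteq> 0"
      proof
        fix z assume "z \<in> ball z0 r"
        then have "good z" using r by (intro r(2)) auto
        then show "\<not> is_pole R z \<and> harm_fun R z \<noteq> 0"
          using nz by (cases "z = z0") (auto simp: good_def harm_zeros_def)
      qed
      from fin out eventually_zero_near_nonzero [OF an nz r(1)] show ?thesis
      proof eventually_elim
        case (elim \<epsilon>)
        have "card (sp_zeros (perturb R z0 \<epsilon>) \<inter> ball z0 r) \<ge> 1" if "harm_regular (perturb R z0 \<epsilon>)"
        proof -
          have "finite (sp_zeros (perturb R z0 \<epsilon>) \<inter> ball z0 r)"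
            using elim(1) that by (auto simp: sp_zeros_def)
          then show ?thesis using elim(3) by (simp add: Suc_le_eq card_gt_0_iff)
        qed
        then show ?case
          unfolding Let_def using nz_ball elim(2) r(1) False nonzero by blast
      qed
    qed
  qed
qed

end
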